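(* Let $n,m$ be positive integers with $m\ge 2$ and $n\ge\sqrt{32m+260}+18$. Then there exist families $\mathcal{B},\mathcal{R}\subset\mathcal{Q}_{n+m}$ with $\mathcal{B}\cap\mathcal{R}=\emptyset$ and $\mathcal{B}\cup\mathcal{R}=\mathcal{Q}_{n+m}$ such that $\mathcal{Q}_m$ is not a weak subposet of $\mathcal{B}$ and $\mathcal{Q}_n$ is not a weak subposet of $\mathcal{R}$ (where $\mathcal{B}$ and $\mathcal{R}$ are ordered by inclusion).
   Context: For a positive integer $N$, the Boolean lattice $\mathcal{Q}_N$ is the power set of $[N]=\{1,\dots,N\}$ ordered by inclusion. For posets $P$ and $Q$, $P$ is a weak subposet of $Q$ if there is an injection $f:P\to Q$ such that $f(x)\le f(y)$ whenever $x\le y$. *)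

theory Defs
  imports Complex_Main
begin

definition boolean_lattice :: "nat \<Rightarrow> nat set set" where
  "boolean_lattice N = Pow {1..N}"

(* A poset is a subset of an ordered type, with the induced order;
   on set types that order is inclusion. *)
definition weak_subposet :: "'a::order set \<Rightarrow> 'b::order set \<Rightarrow> bool" where
  "weak_subposet P Q \<longleftrightarrow> (\<exists>f. f ` P \<subseteq> Q \<and> inj_on f P \<and> mono_on P f)"

end

(*
  Put j = (n - 2) div 2. Blue are the layers j and j + 3, ..., j + m + 1 together with a code S
  inside layer j + 1, where "code" means that no j-set lies in two members of S.
  The blue family meets only m + 1 layers, so a blue copy of Q_m sends its minimum to layer j and
  its atoms to distinct members of S above it, which is impossible.

  The red family meets only n + 1 layers, so a red copy F of Q_n is rank preserving. On singletons
  F is given by an injection a, hence F x = a ` x + one further element for card x = j, j + 1, and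
  injectivity of F forces this further element to be one and the same c for all j-subsets x of a
  set omitting at most one point. So no red copy exists if for every (2j+1)-set X and every c
  outside X some insert c x with x a j-subset of X belongs to S.

  Such a code exists by a union bound: label the sets of layer j + 1 independently by 0, ..., 2d - 1,
  where d bounds the degrees of the Johnson graph, and let S be the sets labelled 0 none of whose
  neighbours is labelled 0. For j-subsets x of X any two of which differ in more than 2 elements
  the events "insert c x is in S" are independent, and there are exponentially many such subsets.
*)
theory Submission
  imports Defs "HOL-Library.FuncSet" "HOL-Library.Disjoint_Sets"
begin

section \<open>Independent sets meeting many families\<close>

text \<open>Independence in counting form: if \<open>P\<close> reads only the coordinates in
  \<open>B\<close> and \<open>Q\<close> only those in \<open>W\<close>, a labelling splits into its
  two restrictions, which can be chosen separately. Gluing inverts the splitting.\<close>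

lemma card_PiE_Un_conj:
  assumes "B \<inter> W = {}"
    and P: "\<And>\<omega> \<omega>'. (\<And>x. x \<in> B \<Longrightarrow> \<omega> x = \<omega>' x) \<Longrightarrow> P \<omega> = P \<omega>'"
    and Q: "\<And>\<omega> \<omega>'. (\<And>x. x \<in> W \<Longrightarrow> \<omega> x = \<omega>' x) \<Longrightarrow> Q \<omega> = Q \<omega>'"
  shows "card {\<omega> \<in> PiE (B \<union> W) F. P \<omega> \<and> Q \<omega>} =
    card {\<omega> \<in> PiE B F. P \<omega>} * card {\<omega> \<in> PiE W F. Q \<omega>}"
proof -
  have "bij_betw (\<lambda>\<omega>. (restrict \<omega> B, restrict \<omega> W)) {\<omega> \<in> PiE (B \<union> W) F. P \<omega> \<and> Q \<omega>}
    ({\<omega> \<in> PiE B F. P \<omega>} \<times> {\<omega> \<in> PiE W F. Q \<omega>})"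
  proof (rule bij_betw_byWitness[where f' = "\<lambda>(u, v) x. if x \<in> B then u x else v x"])
    show "\<forall>\<omega>\<in>{\<omega> \<in> PiE (B \<union> W) F. P \<omega> \<and> Q \<omega>}.
      (case (restrict \<omega> B, restrict \<omega> W) of (u, v) \<Rightarrow> \<lambda>x. if x \<in> B then u x else v x) = \<omega>"
      by (auto simp: fun_eq_iff PiE_def extensional_def)
    show "\<forall>p\<in>{\<omega> \<in> PiE B F. P \<omega>} \<times> {\<omega> \<in> PiE W F. Q \<omega>}.
      (restrict (case p of (u, v) \<Rightarrow> \<lambda>x. if x \<in> B then u x else v x) B,
       restrict (case p of (u, v) \<Rightarrow> \<lambda>x. if x \<in> B then u x else v x) W) = p"
    proof
      fix p assume "p \<in> {\<omega> \<in> PiE B F. P \<omega>} \<times> {\<omega> \<in> PiE W F. Q \<omega>}"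
      then obtain u v where p: "p = (u, v)" and u: "u \<in> PiE B F" and v: "v \<in> PiE W F" by blast
      have "restrict (\<lambda>x. if x \<in> B then u x else v x) B = u"
        using u by (auto simp: fun_eq_iff PiE_def extensional_def)
      moreover have "restrict (\<lambda>x. if x \<in> B then u x else v x) W = v"
        using v assms(1) by (auto simp: fun_eq_iff PiE_def extensional_def)
      ultimately show "(restrict (case p of (u, v) \<Rightarrow> \<lambda>x. if x \<in> B then u x else v x) B,
        restrict (case p of (u, v) \<Rightarrow> \<lambda>x. if x \<in> B then u x else v x) W) = p"
        by (simp add: p)
    qed
    have "P (restrict \<omega> B) = P \<omega>" "Q (restrict \<omega> W) = Q \<omega>" for \<omega>
      by (rule P, simp, rule Q, simp)
    then show "(\<lambda>\<omega>. (restrict \<omega> B, restrict \<omega> W)) ` {\<omega> \<in> PiE (B \<union> W) F. P \<omega> \<and> Q \<omega>}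
      \<subseteq> {\<omega> \<in> PiE B F. P \<omega>} \<times> {\<omega> \<in> PiE W F. Q \<omega>}"
      by (auto simp: PiE_def)
    have "P (\<lambda>x. if x \<in> B then u x else v x) = P u" for u v
      by (rule P) simp
    moreover have "Q (\<lambda>x. if x \<in> B then u x else v x) = Q v" for u v
      by (rule Q) (use assms(1) in auto)
    ultimately show "(\<lambda>(u, v) x. if x \<in> B then u x else v x) `
      ({\<omega> \<in> PiE B F. P \<omega>} \<times> {\<omega> \<in> PiE W F. Q \<omega>}) \<subseteq> {\<omega> \<in> PiE (B \<union> W) F. P \<omega> \<and> Q \<omega>}"
      by (auto simp: PiE_def extensional_def Pi_def)
  qed
  from bij_betw_same_card[OF this] show ?thesis
    by (simp add: card_cartesian_product)
qed

section \<open>Random labellings and their isolated zeros\<close>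

text \<open>Here \<open>Nb\<close> is the neighbourhood function of a graph. Zeros that see another
  zero are dropped, so the surviving points are independent for every labelling.\<close>

definition isolated_zero :: "('a \<Rightarrow> 'a set) \<Rightarrow> ('a \<Rightarrow> nat) \<Rightarrow> 'a \<Rightarrow> bool" where
  "isolated_zero Nb \<omega> s \<longleftrightarrow> \<omega> s = 0 \<and> (\<forall>w\<in>Nb s. \<omega> w \<noteq> 0)"

text \<open>Bernoulli gives (1 - 1/(2d))^b >= 1 - b/(2d) >= 1/2. This is why there are
  \<open>2 * d\<close> labels: at most \<open>d\<close> neighbours all avoid the label 0 with
  probability at least 1/2.\<close>

lemma two_mult_pred_power_ge:
  fixes b d :: nat
  assumes "b \<le> d" "d > 0"
  shows "2 * (2 * d - 1) ^ b \<ge> (2 * d) ^ b"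
proof -
  define D where "D = real (2 * d)"
  have D: "D \<ge> 2" "real b \<le> D / 2" using assms by (auto simp: D_def)
  have "1 / 2 \<le> 1 + real b * (- 1 / D)"
    using D by (simp add: field_simps)
  also have "\<dots> \<le> (1 + (- 1 / D)) ^ b"
    by (rule Bernoulli_inequality) (use D in \<open>simp add: field_simps\<close>)
  also have "1 + (- 1 / D) = (D - 1) / D"
    using D by (simp add: field_simps)
  finally have le: "D ^ b \<le> 2 * (D - 1) ^ b"
    using D by (simp add: power_divide field_simps)
  have D1: "D - 1 = real (2 * d - 1)" using assms unfolding D_def by linarith
  have "real ((2 * d) ^ b) = D ^ b" by (simp add: D_def)
  also note le
  also have "2 * (D - 1) ^ b = real (2 * (2 * d - 1) ^ b)"
    unfolding D1 by (metis of_nat_mult of_nat_numeral of_nat_power)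
  finally have "real ((2 * d) ^ b) \<le> real (2 * (2 * d - 1) ^ b)" .
  then show ?thesis unfolding of_nat_le_iff .
qed

text \<open>A uniform label at \<open>s\<close> is 0 with probability 1/(2d), and independently all
  neighbours avoid 0 with probability at least 1/2. Hence \<open>s\<close> fails with probability at
  most 1 - 1/(4d); denominators are cleared to stay in the naturals.\<close>

lemma card_not_isolated_zero_le:
  assumes "finite (Nb s)" "s \<notin> Nb s" "card (Nb s) \<le> d" "d > 0"
  shows "4 * d * card {\<omega> \<in> PiE (insert s (Nb s)) (\<lambda>_. {..<2 * d}). \<not> isolated_zero Nb \<omega> s}
    \<le> (4 * d - 1) * (2 * d) ^ card (insert s (Nb s))"
proof -
  let ?A = "PiE (insert s (Nb s)) (\<lambda>_. {..<2 * d})"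
  let ?b = "card (Nb s)"
  have fin: "finite ?A" using assms by (intro finite_PiE) auto
  have cA: "card ?A = (2 * d) ^ (?b + 1)"
    using assms by (simp add: card_PiE)
  \<comment> \<open>The good labellings again form a product set: 0 is forced at \<open>s\<close>
    and excluded on \<open>Nb s\<close>.\<close>
  have "{\<omega> \<in> ?A. isolated_zero Nb \<omega> s} =
    PiE (insert s (Nb s)) (\<lambda>x. if x = s then {0} else {1..<2 * d})"
    (is "?L = ?R")
  proof (intro set_eqI iffI)
    fix \<omega> assume "\<omega> \<in> ?L"
    then show "\<omega> \<in> ?R" using assms(2)
      by (auto simp: PiE_iff isolated_zero_def)
  next
    fix \<omega> assume \<omega>: "\<omega> \<in> ?R"
    have "\<omega> s = 0" using PiE_mem[OF \<omega>, of s] by simp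
    moreover have "1 \<le> \<omega> w \<and> \<omega> w < 2 * d" if "w \<in> Nb s" for w
    proof -
      have "w \<noteq> s" using assms(2) that by blast
      then show ?thesis using PiE_mem[OF \<omega>, of w] that by simp
    qed
    ultimately show "\<omega> \<in> ?L" using \<omega> assms(4)
      by (fastforce simp: PiE_iff isolated_zero_def)
  qed
  then have "card {\<omega> \<in> ?A. isolated_zero Nb \<omega> s} =
      (\<Prod>x\<in>insert s (Nb s). card (if x = s then {0} else {1..<2 * d}))"
    using assms by (simp add: card_PiE)
  also have "\<dots> = (\<Prod>x\<in>Nb s. card (if x = s then {0} else {1..<2 * d}))"
    using assms by simp
  also have "\<dots> = (\<Prod>x\<in>Nb s. 2 * d - 1)"
    by (rule prod.cong) (use assms in auto)
  finally have cg: "card {\<omega> \<in> ?A. isolated_zero Nb \<omega> s} = (2 * d - 1) ^ ?b"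
    by simp
  have "{\<omega> \<in> ?A. \<not> isolated_zero Nb \<omega> s} = ?A - {\<omega> \<in> ?A. isolated_zero Nb \<omega> s}"
    by auto
  then have cb: "card {\<omega> \<in> ?A. \<not> isolated_zero Nb \<omega> s} = (2 * d) ^ (?b + 1) - (2 * d - 1) ^ ?b"
    using cA cg fin by (simp add: card_Diff_subset)
  define p where "p = (2 * d) ^ (?b + 1)"
  define g where "g = (2 * d - 1) ^ ?b"
  have "p \<le> 4 * d * g"
    using mult_left_mono[OF two_mult_pred_power_ge[OF assms(3,4)], of "2 * d"]
    by (simp add: p_def g_def mult_ac)
  \<comment> \<open>After expansion the terms \<open>4 * d * p\<close> cancel and
    \<open>p \<le> 4 * d * g\<close> remains.\<close>
  then have "4 * d * (p - g) \<le> (4 * d - 1) * p"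
    unfolding diff_mult_distrib diff_mult_distrib2 by linarith
  then show ?thesis
    unfolding cb p_def g_def using assms by simp
qed

text \<open>Disjoint closed neighbourhoods make the failures independent, so all of \<open>T\<close>
  fails with probability at most (1 - 1/(4d))^|T|. The induction splits off one closed neighbourhood
  and continues on the rest of the ground set, so \<open>V\<close> must vary.\<close>

lemma card_no_isolated_zero_le:
  assumes "finite T" "finite V" "d > 0"
    and "\<And>s. s \<in> T \<Longrightarrow> insert s (Nb s) \<subseteq> V \<and> s \<notin> Nb s \<and> card (Nb s) \<le> d"
    and "disjoint_family_on (\<lambda>s. insert s (Nb s)) T"
  shows "(4 * d) ^ card T *
      card {\<omega> \<in> PiE V (\<lambda>_. {..<2 * d}). \<forall>s\<in>T. \<not> isolated_zero Nb \<omega> s}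
    \<le> (4 * d - 1) ^ card T * (2 * d) ^ card V"
  using assms(1,2,4,5)
proof (induction T arbitrary: V rule: finite_induct)
  case empty
  then show ?case by (simp add: card_PiE)
next
  case (insert s T)
  define B where "B = insert s (Nb s)"
  define W where "W = V - B"
  let ?F = "\<lambda>_. {..<2 * d}"
  have B: "B \<subseteq> V" using insert.prems by (auto simp: B_def)
  then have fB: "finite B" using insert.prems(1) finite_subset by blast
  have V: "V = B \<union> W" "B \<inter> W = {}" "finite W" using B insert.prems(1) by (auto simp: W_def)
  have TW: "insert t (Nb t) \<subseteq> W \<and> t \<notin> Nb t \<and> card (Nb t) \<le> d" if "t \<in> T" for t
  proof -
    have "insert t (Nb t) \<inter> B = {}"
      using insert.prems(3) insert.hyps(2) that
      by (auto simp: disjoint_family_on_def B_def)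
    then show ?thesis using insert.prems(2)[of t] that by (auto simp: W_def)
  qed
  have "card {\<omega> \<in> PiE V ?F. \<forall>s\<in>insert s T. \<not> isolated_zero Nb \<omega> s} =
     card {\<omega> \<in> PiE (B \<union> W) ?F. \<not> isolated_zero Nb \<omega> s \<and> (\<forall>s\<in>T. \<not> isolated_zero Nb \<omega> s)}"
    by (simp add: V(1))
  also have "\<dots> = card {\<omega> \<in> PiE B ?F. \<not> isolated_zero Nb \<omega> s} *
      card {\<omega> \<in> PiE W ?F. \<forall>s\<in>T. \<not> isolated_zero Nb \<omega> s}"
  proof (rule card_PiE_Un_conj[OF V(2)])
    fix \<omega> \<omega>' :: "'a \<Rightarrow> nat"
    show "(\<not> isolated_zero Nb \<omega> s) = (\<not> isolated_zero Nb \<omega>' s)"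
      if "\<And>x. x \<in> B \<Longrightarrow> \<omega> x = \<omega>' x"
      using that by (auto simp: isolated_zero_def B_def)
    show "(\<forall>s\<in>T. \<not> isolated_zero Nb \<omega> s) = (\<forall>s\<in>T. \<not> isolated_zero Nb \<omega>' s)"
      if *: "\<And>x. x \<in> W \<Longrightarrow> \<omega> x = \<omega>' x"
    proof -
      have "isolated_zero Nb \<omega> t = isolated_zero Nb \<omega>' t" if "t \<in> T" for t
        using TW[OF that] * by (auto simp: isolated_zero_def subset_iff)
      then show ?thesis by auto
    qed
  qed
  finally have split: "card {\<omega> \<in> PiE V ?F. \<forall>s\<in>insert s T. \<not> isolated_zero Nb \<omega> s} = \<dots>" .
  have 1: "4 * d * card {\<omega> \<in> PiE B ?F. \<not> isolated_zero Nb \<omega> s} \<le> (4 * d - 1) * (2 * d) ^ card B"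
    unfolding B_def using insert.prems(2)[of s] fB assms(3)
    by (intro card_not_isolated_zero_le) (auto simp: B_def)
  have 2: "(4 * d) ^ card T * card {\<omega> \<in> PiE W ?F. \<forall>s\<in>T. \<not> isolated_zero Nb \<omega> s}
      \<le> (4 * d - 1) ^ card T * (2 * d) ^ card W"
    using insert.prems(3) by (intro insert.IH V(3) TW) (auto simp: disjoint_family_on_def)
  have cV: "card V = card B + card W" using V fB by (simp add: card_Un_disjoint)
  show ?case
    unfolding split using mult_mono[OF 1 2] insert.hyps
    by (simp add: cV power_add mult_ac)
qed

text \<open>Union bound: the isolated zeros miss a given \<open>T i\<close> with probability at most
  (1 - 1/(4d))^t, and \<open>less\<close> says that \<open>card I\<close> times this is below 1. So
  some labelling misses none of the families.\<close>

lemma independent_transversal: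
  assumes V: "finite V" and I: "finite I" and d: "d > 0"
    and Nb: "\<And>s. s \<in> V \<Longrightarrow> Nb s \<subseteq> V \<and> s \<notin> Nb s \<and> card (Nb s) \<le> d"
    and T: "\<And>i. i \<in> I \<Longrightarrow> T i \<subseteq> V \<and> card (T i) \<ge> t \<and>
      disjoint_family_on (\<lambda>s. insert s (Nb s)) (T i)"
    and less: "card I * (4 * d - 1) ^ t < (4 * d) ^ t"
  obtains S where "S \<subseteq> V" "\<And>s. s \<in> S \<Longrightarrow> Nb s \<inter> S = {}" "\<And>i. i \<in> I \<Longrightarrow> S \<inter> T i \<noteq> {}"
proof -
  let ?A = "PiE V (\<lambda>_. {..<2 * d})"
  define bad where "bad i = {\<omega> \<in> ?A. \<forall>s\<in>T i. \<not> isolated_zero Nb \<omega> s}" for i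
  have bad: "(4 * d) ^ t * card (bad i) \<le> (4 * d - 1) ^ t * card ?A" if i: "i \<in> I" for i
  proof -
    \<comment> \<open>Trimming to exactly \<open>t\<close> members gives every index the same
      exponent.\<close>
    obtain U where U: "U \<subseteq> T i" "card U = t" using T[OF i] obtain_subset_with_card_n by metis
    have UV: "U \<subseteq> V" using U T[OF i] by auto
    then have fU: "finite U" using V finite_subset by blast
    have fA: "finite ?A" using V by (intro finite_PiE) auto
    have "card (bad i) \<le> card {\<omega> \<in> ?A. \<forall>s\<in>U. \<not> isolated_zero Nb \<omega> s}"
      unfolding bad_def using fA U by (intro card_mono) auto
    moreover have "(4 * d) ^ card U * card {\<omega> \<in> ?A. \<forall>s\<in>U. \<not> isolated_zero Nb \<omega> s}
        \<le> (4 * d - 1) ^ card U * (2 * d) ^ card V"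
    proof (rule card_no_isolated_zero_le[OF fU V d])
      show "insert s (Nb s) \<subseteq> V \<and> s \<notin> Nb s \<and> card (Nb s) \<le> d" if "s \<in> U" for s
        using Nb[of s] UV that by auto
      show "disjoint_family_on (\<lambda>s. insert s (Nb s)) U"
        using T[OF i] U(1) disjoint_family_on_mono by blast
    qed
    moreover have "card ?A = (2 * d) ^ card V" using V by (simp add: card_PiE)
    ultimately show ?thesis
      using U(2) by (metis (no_types, lifting) le_trans mult_le_mono2)
  qed
  have fA: "finite ?A" using V by (intro finite_PiE) auto
  have A0: "card ?A > 0" using V d by (simp add: card_PiE)
  have "(4 * d) ^ t * card (\<Union>i\<in>I. bad i) \<le> (4 * d) ^ t * (\<Sum>i\<in>I. card (bad i))"
    using I by (intro mult_left_mono card_UN_le) auto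
  also have "\<dots> \<le> (\<Sum>i\<in>I. (4 * d - 1) ^ t * card ?A)"
    unfolding sum_distrib_left by (rule sum_mono) (rule bad)
  also have "\<dots> = card I * (4 * d - 1) ^ t * card ?A" by simp
  also have "\<dots> < (4 * d) ^ t * card ?A" using less A0 by simp
  finally have "card (\<Union>i\<in>I. bad i) < card ?A" by simp
  moreover have "finite (\<Union>i\<in>I. bad i)"
    using I fA by (auto simp: bad_def)
  ultimately have "\<not> ?A \<subseteq> (\<Union>i\<in>I. bad i)"
    using card_mono leD by blast
  then obtain \<omega> where \<omega>: "\<omega> \<in> ?A" "\<And>i. i \<in> I \<Longrightarrow> \<omega> \<notin> bad i" by blast
  show ?thesis
  proof (rule that[of "{s \<in> V. isolated_zero Nb \<omega> s}"])
    show "{s \<in> V. isolated_zero Nb \<omega> s} \<inter> T i \<noteq> {}" if "i \<in> I" for i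
      using \<omega>(1) \<omega>(2)[OF that] T[OF that] by (auto simp: bad_def)
  qed (auto simp: isolated_zero_def)
qed

section \<open>Packing by a maximal separated set\<close>

text \<open>Gilbert-Varshamov argument: a separated set of greatest size cannot be extended, so the
  balls \<open>C x\<close> around its points cover \<open>V\<close>.\<close>

lemma separated_subset_exists:
  assumes "finite V" and refl: "\<And>x. x \<in> V \<Longrightarrow> x \<in> C x"
    and sym: "\<And>x y. x \<in> V \<Longrightarrow> y \<in> V \<Longrightarrow> x \<in> C y \<Longrightarrow> y \<in> C x"
    and card: "\<And>x. x \<in> V \<Longrightarrow> finite (C x) \<and> card (C x) \<le> b"
  obtains T where "T \<subseteq> V" "\<And>x y. x \<in> T \<Longrightarrow> y \<in> T \<Longrightarrow> x \<noteq> y \<Longrightarrow> y \<notin> C x" "card V \<le> card T * b"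
proof -
  let ?P = "\<lambda>T. T \<subseteq> V \<and> (\<forall>x\<in>T. \<forall>y\<in>T. x \<noteq> y \<longrightarrow> y \<notin> C x)"
  obtain T where T: "?P T" and max: "\<And>T'. ?P T' \<Longrightarrow> card T' \<le> card T"
  proof -
    have "?P T \<Longrightarrow> card T \<le> card V" for T using assms(1) by (simp add: card_mono)
    then have "\<forall>T. ?P T \<longrightarrow> card T < Suc (card V)" by (simp add: less_Suc_eq_le)
    moreover have "?P {}" by simp
    ultimately have "\<exists>T. ?P T \<and> (\<forall>T'. ?P T' \<longrightarrow> card T' \<le> card T)"
      by (rule ex_has_greatest_nat[rotated])
    then show thesis using that by (elim exE conjE) simp
  qed
  have fT: "finite T" using T assms(1) finite_subset by blast
  have "V \<subseteq> (\<Union>x\<in>T. C x)"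
  proof
    fix v assume v: "v \<in> V"
    show "v \<in> (\<Union>x\<in>T. C x)"
    proof (rule ccontr)
      assume n: "v \<notin> (\<Union>x\<in>T. C x)"
      then have "v \<notin> T" using T refl by auto
      moreover have "?P (insert v T)"
      proof (intro conjI ballI impI)
        show "insert v T \<subseteq> V" using T v by simp
        fix x y assume xy: "x \<in> insert v T" "y \<in> insert v T" "x \<noteq> y"
        have nv: "v \<notin> C z" "z \<notin> C v" if "z \<in> T" for z
          using n T sym[of z v] v that by auto
        show "y \<notin> C x" using xy nv T by (cases "x = v"; cases "y = v") auto
      qed
      ultimately show False using max[of "insert v T"] fT by simp
    qed
  qed
  then have "card V \<le> card (\<Union>x\<in>T. C x)"
    using fT T card by (intro card_mono) auto
  also have "\<dots> \<le> (\<Sum>x\<in>T. card (C x))" using fT by (rule card_UN_le)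
  also have "\<dots> \<le> (\<Sum>x\<in>T. b)" using T card by (intro sum_mono) auto
  finally show ?thesis using that[of T] T by auto
qed

section \<open>Codes in the Johnson graph\<close>

lemma card_Diff_sym:
  assumes "finite s" "finite w" "card s = card w"
  shows "card (w - s) = card (s - w)"
proof -
  have "card (w - s) + card (w \<inter> s) = card w" "card (s - w) + card (s \<inter> w) = card s"
    using assms by (auto simp: card_Diff_subset_Int card_mono)
  then show ?thesis using assms(3) by (simp add: Int_commute)
qed

text \<open>Doubling turns the count 1 + k + k(k-1)/2 into a polynomial free of division.\<close>

lemma two_card_subsets_le_2:
  assumes "finite A"
  shows "2 * card {B. B \<subseteq> A \<and> card B \<le> 2} = card A ^ 2 + card A + 2"
proof -
  have fin: "finite {B. B \<subseteq> A \<and> card B = k}" for k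
    using assms by simp
  have "{B. B \<subseteq> A \<and> card B \<le> 2} =
      (\<Union>k\<in>{0, 1, 2}. {B. B \<subseteq> A \<and> card B = k})"
    by auto
  also have "card \<dots> = (\<Sum>k\<in>{0, 1, 2}. card {B. B \<subseteq> A \<and> card B = k})"
    by (rule card_UN_disjoint) (use fin in auto)
  also have "\<dots> = (\<Sum>k\<in>{0, 1, 2}. card A choose k)"
    by (intro sum.cong refl n_subsets assms)
  also have "\<dots> = 1 + card A + (card A choose 2)" by simp
  finally have "card {B. B \<subseteq> A \<and> card B \<le> 2} = 1 + card A + (card A choose 2)" .
  moreover have "2 * (card A choose 2) = card A * (card A - 1)"
    by (subst choose_two) (simp add: even_mult_iff, cases "card A", auto)
  ultimately show ?thesis
    by (cases "card A") (auto simp: power2_eq_square)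
qed

text \<open>Bounds a ball of radius 2 in the Johnson graph on \<open>X\<close>: \<open>y\<close> is
  determined by the elements it loses and gains relative to \<open>x\<close>, at most two of each.
  The factor 4 collects two doublings.\<close>

lemma four_card_near_subsets_le:
  assumes "finite X" "x \<subseteq> X"
  shows "4 * card {y. y \<subseteq> X \<and> card y = card x \<and> card (x - y) \<le> 2}
    \<le> (card x ^ 2 + card x + 2) * (card (X - x) ^ 2 + card (X - x) + 2)"
proof -
  let ?C = "{y. y \<subseteq> X \<and> card y = card x \<and> card (x - y) \<le> 2}"
  let ?P = "\<lambda>A. {B. B \<subseteq> A \<and> card B \<le> 2}"
  have fx: "finite x" using assms finite_subset by blast
  have "inj_on (\<lambda>y. (x - y, y - x)) ?C" by (auto simp: inj_on_def)
  moreover have "(\<lambda>y. (x - y, y - x)) ` ?C \<subseteq> ?P x \<times> ?P (X - x)"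
  proof (rule image_subsetI)
    fix y assume "y \<in> ?C"
    then have y: "y \<subseteq> X" "card y = card x" "card (x - y) \<le> 2" by auto
    then have "card (y - x) \<le> 2"
      using card_Diff_sym[OF fx finite_subset[OF y(1) assms(1)]] by simp
    then show "(x - y, y - x) \<in> ?P x \<times> ?P (X - x)" using y by auto
  qed
  moreover have "finite (?P x \<times> ?P (X - x))" using fx assms by simp
  ultimately have "card ?C \<le> card (?P x \<times> ?P (X - x))" by (rule card_inj_on_le)
  then have "4 * card ?C \<le> (2 * card (?P x)) * (2 * card (?P (X - x)))"
    by (simp add: card_cartesian_product)
  then show ?thesis
    using fx assms by (simp only: two_card_subsets_le_2 finite_Diff)
qed

text \<open>With p = q - 1, Bernoulli gives (1 + 1/p)^q >= 1 + q/p >= 2.\<close>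

lemma two_mult_pred_power_self_le:
  fixes q :: nat
  assumes "q \<ge> 2"
  shows "2 * (q - 1) ^ q \<le> q ^ q"
proof -
  obtain p where q: "q = Suc p" and p: "p > 0" using assms by (cases q) auto
  have "2 \<le> 1 + real (Suc p) * (1 / real p)" using p by (simp add: field_simps)
  also have "\<dots> \<le> (1 + 1 / real p) ^ Suc p"
    by (rule Bernoulli_inequality) (use p in \<open>simp add: field_simps\<close>)
  also have "1 + 1 / real p = real (Suc p) / real p" using p by (simp add: field_simps)
  finally have "2 * real p ^ Suc p \<le> real (Suc p) ^ Suc p"
    unfolding power_divide using p by (subst (asm) pos_le_divide_eq) auto
  then have "real (2 * p ^ Suc p) \<le> real (Suc p ^ Suc p)"
    by (simp only: of_nat_mult of_nat_power of_nat_numeral)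
  then show ?thesis unfolding q diff_Suc_1 of_nat_le_iff .
qed

text \<open>Each block of \<open>q\<close> factors 1 - 1/q contributes at most 1/2, and the leftover
  factors at most 1. With \<open>q\<close> equal to 4d this defeats the number of events in the
  union bound.\<close>

lemma power_two_mult_pred_power_le:
  fixes q k t :: nat
  assumes "q \<ge> 2" "q * k \<le> t"
  shows "2 ^ k * (q - 1) ^ t \<le> q ^ t"
proof -
  obtain r where t: "t = q * k + r" using assms(2) le_Suc_ex by blast
  have "2 ^ k * (q - 1) ^ (q * k) = (2 * (q - 1) ^ q) ^ k"
    by (simp only: power_mult_distrib power_mult)
  also have "\<dots> \<le> (q ^ q) ^ k"
    by (intro power_mono two_mult_pred_power_self_le assms) simp
  finally have "2 ^ k * (q - 1) ^ (q * k) \<le> q ^ (q * k)" by (simp only: power_mult)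
  moreover have "(q - 1) ^ r \<le> q ^ r" by (intro power_mono) auto
  ultimately have "2 ^ k * (q - 1) ^ (q * k) * (q - 1) ^ r \<le> q ^ (q * k) * q ^ r"
    by (rule mult_mono) auto
  then show ?thesis by (simp only: t power_add mult.assoc)
qed

text \<open>Degree bound for the Johnson graph: a neighbour of \<open>s\<close> arises by exchanging
  some \<open>a\<close> in \<open>s\<close> for some \<open>b\<close> outside, and the pair
  determines it.\<close>

lemma card_swaps_le:
  assumes E: "finite E" and s: "s \<subseteq> E"
  shows "card {w. w \<subseteq> E \<and> card w = card s \<and> w \<noteq> s \<and> card (s - w) \<le> 1} \<le> card s * card (E - s)"
proof -
  have fs: "finite s" using assms finite_subset by blast
  have "{w. w \<subseteq> E \<and> card w = card s \<and> w \<noteq> s \<and> card (s - w) \<le> 1}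
      \<subseteq> (\<lambda>(a, b). insert b (s - {a})) ` (s \<times> (E - s))"
  proof
    fix w assume "w \<in> {w. w \<subseteq> E \<and> card w = card s \<and> w \<noteq> s \<and> card (s - w) \<le> 1}"
    then have w: "w \<subseteq> E" "card w = card s" "w \<noteq> s" "card (s - w) \<le> 1" by auto
    have fw: "finite w" using w E finite_subset by blast
    have "\<not> s \<subseteq> w" using card_subset_eq[OF fw] w by auto
    then have "card (s - w) = 1" using w(4) fs by (simp add: le_Suc_eq)
    moreover from this have "card (w - s) = 1" using card_Diff_sym[OF fs fw] w by simp
    ultimately obtain a b where ab: "s - w = {a}" "w - s = {b}"
      by (auto simp: card_1_singleton_iff)
    then have "w = insert b (s - {a})" "a \<in> s" "b \<in> E - s" using w(1) by auto
    then show "w \<in> (\<lambda>(a, b). insert b (s - {a})) ` (s \<times> (E - s))" by force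
  qed
  then have "card {w. w \<subseteq> E \<and> card w = card s \<and> w \<noteq> s \<and> card (s - w) \<le> 1}
      \<le> card ((\<lambda>(a, b). insert b (s - {a})) ` (s \<times> (E - s)))"
    using fs E by (intro card_mono) auto
  also have "\<dots> \<le> card (s \<times> (E - s))" using fs E by (intro card_image_le) auto
  finally show ?thesis by (simp add: card_cartesian_product)
qed

lemma four_mult_le_square_add:
  fixes a b :: nat
  shows "4 * (a * b) \<le> (a + b) ^ 2"
proof -
  have "0 \<le> (int a - int b) ^ 2" by simp
  then have "int (4 * (a * b)) \<le> int ((a + b) ^ 2)"
    by (simp add: power2_eq_square algebra_simps)
  then show ?thesis unfolding of_nat_le_iff .
qed

text \<open>Applies \<open>independent_transversal\<close> to the Johnson graph on layer
  \<open>j + 1\<close>, with one index per pair \<open>(X, c)\<close>. By \<open>num\<close> every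
  \<open>X\<close> has room for 2N^3 well separated \<open>j\<close>-subsets; as 4d <= N^2, so many
  trials all fail with probability at most 2^(-2N), while there are fewer than 2^(2N) pairs.\<close>

lemma exists_johnson_code:
  fixes E :: "'a set" and j :: nat
  defines "N \<equiv> card E"
  assumes E: "finite E" and jN: "j + 2 \<le> N"
    and num: "N ^ 3 * ((j ^ 2 + j + 2) * (j ^ 2 + 3 * j + 4)) \<le> 2 * ((2 * j + 1) choose j)"
  obtains S where "S \<subseteq> {s. s \<subseteq> E \<and> card s = j + 1}"
    "\<And>s t z. s \<in> S \<Longrightarrow> t \<in> S \<Longrightarrow> z \<subseteq> s \<inter> t \<Longrightarrow> card z = j \<Longrightarrow> s = t"
    "\<And>X c. X \<subseteq> E \<Longrightarrow> card X = 2 * j + 1 \<Longrightarrow> c \<in> E - X \<Longrightarrow>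
      \<exists>x\<subseteq>X. card x = j \<and> insert c x \<in> S"
proof -
  define V where "V = {s. s \<subseteq> E \<and> card s = j + 1}"
  \<comment> \<open>Johnson adjacency. In layer \<open>j + 1\<close> it means being distinct and
    sharing a \<open>j\<close>-set, so the independent sets are the codes.\<close>
  define Nb where "Nb s = {w. w \<subseteq> E \<and> card w = card s \<and> w \<noteq> s \<and> card (s - w) \<le> 1}" for s
  define d where "d = (j + 1) * (N - (j + 1))"
  define t where "t = 2 * N ^ 3"
  define I where "I = {(X, c). X \<subseteq> E \<and> card X = 2 * j + 1 \<and> c \<in> E - X}"
  \<comment> \<open>Four times the bound for a ball of radius 2 around a \<open>j\<close>-subset of
    a set with 2j + 1 elements.\<close>
  define Q where "Q = (j ^ 2 + j + 2) * (j ^ 2 + 3 * j + 4)"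
  have fE: "finite x" if "x \<subseteq> E" for x using that E finite_subset by blast
  have "\<exists>U. U \<subseteq> {x. x \<subseteq> X \<and> card x = j} \<and> t \<le> card U \<and>
      disjoint_family_on (\<lambda>s. insert s (Nb s)) (insert c ` U)"
    if "(X, c) \<in> I" for X c
  proof -
    have X: "X \<subseteq> E" "card X = 2 * j + 1" "c \<in> E" "c \<notin> X" "finite X"
      using that fE by (auto simp: I_def)
    let ?V = "{x. x \<subseteq> X \<and> card x = j}"
    define C where "C x = {y. y \<subseteq> X \<and> card y = card x \<and> card (x - y) \<le> 2}" for x
    have fX: "finite x" if "x \<subseteq> X" for x using that X finite_subset by blast
    have C1: "card (C x) \<le> Q div 4" if x: "x \<in> ?V" for x
    proof -
      have cx: "card x = j" "card (X - x) = j + 1"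
        using x X fX by (auto simp: card_Diff_subset)
      have "4 * card (C x) \<le> (j ^ 2 + j + 2) * ((j + 1) ^ 2 + (j + 1) + 2)"
        using four_card_near_subsets_le[of X x] x X(5) unfolding C_def cx by auto
      also have "(j + 1) ^ 2 + (j + 1) + 2 = j ^ 2 + 3 * j + 4"
        by (simp add: power2_eq_square)
      finally show ?thesis unfolding Q_def by linarith
    qed
    have C2: "finite (C x)" for x using X(5) by (simp add: C_def)
    have C3: "x \<in> C y \<Longrightarrow> y \<in> C x" if "x \<in> ?V" "y \<in> ?V" for x y
      using that card_Diff_sym[of x y] fX by (auto simp: C_def)
    have C4: "x \<in> C x" if "x \<in> ?V" for x using that by (simp add: C_def)
    have fV: "finite ?V" using X(5) by simp
    obtain U where U: "U \<subseteq> ?V"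
      "\<And>x y. x \<in> U \<Longrightarrow> y \<in> U \<Longrightarrow> x \<noteq> y \<Longrightarrow> y \<notin> C x" "card ?V \<le> card U * (Q div 4)"
      using separated_subset_exists[OF fV C4 C3 conjI[OF C2 C1]] by blast
    \<comment> \<open>Rounding in \<open>Q div 4\<close> goes the right way, since
      \<open>4 * (Q div 4) \<le> Q\<close>; cancelling \<open>Q\<close> leaves the wanted size
      \<open>t\<close>.\<close>
    have "N ^ 3 * Q \<le> 2 * card ?V" using num X by (simp add: Q_def n_subsets)
    also have "\<dots> \<le> 2 * (card U * (Q div 4))" using U(3) by simp
    finally have "2 * N ^ 3 * Q \<le> card U * (4 * (Q div 4))" by (simp only: mult_ac)
    also have "\<dots> \<le> card U * Q" by (intro mult_left_mono) auto
    finally have "t \<le> card U" by (simp add: t_def Q_def)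
    moreover have "disjoint_family_on (\<lambda>s. insert s (Nb s)) (insert c ` U)"
      unfolding disjoint_family_on_def
    proof (intro ballI impI, rule ccontr)
      fix s s' assume s: "s \<in> insert c ` U" "s' \<in> insert c ` U" "s \<noteq> s'"
        and ne: "insert s (Nb s) \<inter> insert s' (Nb s') \<noteq> {}"
      obtain x x' where x: "s = insert c x" "s' = insert c x'" "x \<in> U" "x' \<in> U" using s by auto
      then have xX: "x \<subseteq> X" "x' \<subseteq> X" "card x = j" "card x' = j" "x \<noteq> x'" using U s by auto
      have cs: "card s = j + 1" "card s' = j + 1" "s \<subseteq> E" "s' \<subseteq> E"
        using x xX X fX[of x] fX[of x'] by (auto simp: card_insert_if)
      \<comment> \<open>Triangle inequality: a common member \<open>w\<close> puts \<open>s\<close>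
        and \<open>s'\<close> within distance 2. Both contain \<open>c\<close>, so \<open>x\<close>
        and \<open>x'\<close> would be equally close, against their separation.\<close>
      obtain w where w: "w \<in> insert s (Nb s)" "w \<in> insert s' (Nb s')" using ne by auto
      have w1: "w \<subseteq> E" "card (s - w) \<le> 1" "card (s' - w) \<le> 1" "card w = j + 1"
        using w cs by (auto simp: Nb_def)
      have "card (w - s') \<le> 1"
        using card_Diff_sym[of s' w] w1 cs fE by auto
      moreover have "card (s - s') \<le> card ((s - w) \<union> (w - s'))"
        using w1 cs fE by (intro card_mono) auto
      ultimately have "card (s - s') \<le> 2"
        using card_Un_le[of "s - w" "w - s'"] w1 by linarith
      moreover have "s - s' = x - x'" using x xX X by auto
      ultimately have "x' \<in> C x" using xX by (simp add: C_def)
      then show False using U(2)[of x x'] x xX by auto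
    qed
    ultimately show ?thesis using U(1) by blast
  qed
  then have "\<forall>p\<in>I. \<exists>U. U \<subseteq> {x. x \<subseteq> fst p \<and> card x = j} \<and> t \<le> card U \<and>
      disjoint_family_on (\<lambda>s. insert s (Nb s)) (insert (snd p) ` U)" by auto
  from bchoice[OF this] obtain U where "\<forall>p\<in>I. U p \<subseteq> {x. x \<subseteq> fst p \<and> card x = j} \<and> t \<le> card (U p) \<and>
      disjoint_family_on (\<lambda>s. insert s (Nb s)) (insert (snd p) ` U p)" by (rule exE)
  then have U: "U p \<subseteq> {x. x \<subseteq> fst p \<and> card x = j} \<and> t \<le> card (U p) \<and>
      disjoint_family_on (\<lambda>s. insert s (Nb s)) (insert (snd p) ` U p)" if "p \<in> I" for p
    using that by (rule bspec)
  have I: "I \<subseteq> Pow E \<times> E" by (auto simp: I_def)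
  have fI: "finite I" using I E finite_subset by blast
  have "card I \<le> card (Pow E \<times> E)" using I E by (intro card_mono) auto
  then have cI: "card I \<le> 2 ^ N * N" using E by (simp add: card_cartesian_product card_Pow N_def)
  have d: "d > 0" using jN by (simp add: d_def)
  \<comment> \<open>AM-GM for the two factors of \<open>d\<close>, whose sum is
    \<open>N\<close>.\<close>
  have "4 * d \<le> N ^ 2"
    using four_mult_le_square_add[of "j + 1" "N - (j + 1)"] jN by (simp add: d_def)
  then have "4 * d * (2 * N) \<le> t"
    using mult_right_mono[of "4 * d" "N ^ 2" "2 * N"] by (simp add: t_def power2_eq_square power3_eq_cube)
  then have pw: "2 ^ (2 * N) * (4 * d - 1) ^ t \<le> (4 * d) ^ t"
    using d by (intro power_two_mult_pred_power_le) auto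
  have "card I < 2 ^ (2 * N)"
  proof -
    have "card I \<le> 2 ^ N * N" by (rule cI)
    also have "\<dots> < 2 ^ N * 2 ^ N" by simp
    finally show ?thesis by (simp add: mult_2 power_add)
  qed
  then have "card I * (4 * d - 1) ^ t < 2 ^ (2 * N) * (4 * d - 1) ^ t" using d by simp
  then have less: "card I * (4 * d - 1) ^ t < (4 * d) ^ t" using pw by linarith
  have fV: "finite V" using E by (simp add: V_def)
  have Nb: "Nb s \<subseteq> V \<and> s \<notin> Nb s \<and> card (Nb s) \<le> d" if "s \<in> V" for s
  proof -
    have "card (E - s) = N - (j + 1)" using that fE by (auto simp: V_def N_def card_Diff_subset)
    then show ?thesis
      using that card_swaps_le[OF E, of s] by (auto simp: V_def Nb_def d_def)
  qed
  have T: "insert (snd p) ` U p \<subseteq> V \<and> t \<le> card (insert (snd p) ` U p) \<and>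
      disjoint_family_on (\<lambda>s. insert s (Nb s)) (insert (snd p) ` U p)" if p: "p \<in> I" for p
  proof -
    obtain X c where pc: "p = (X, c)" by (cases p)
    have X: "X \<subseteq> E" "c \<in> E" "c \<notin> X" using p by (auto simp: I_def pc)
    have Up: "U p \<subseteq> {x. x \<subseteq> X \<and> card x = j}" using U[OF p] by (simp add: pc)
    have "inj_on (insert c) (U p)"
    proof (rule inj_onI)
      fix x y assume "x \<in> U p" "y \<in> U p" "insert c x = insert c y"
      moreover have "c \<notin> x" if "x \<in> U p" for x using Up X(3) that by auto
      ultimately show "x = y" using insert_ident[of c x y] by simp
    qed
    then have "card (insert c ` U p) = card (U p)" by (rule card_image)
    moreover have "insert c x \<in> V" if "x \<in> U p" for x
    proof -
      have x: "x \<subseteq> X" "card x = j" using Up that by auto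
      then have "finite x" "c \<notin> x" using X fE by auto
      then show ?thesis using x X by (auto simp: V_def)
    qed
    ultimately show ?thesis using U[OF p] by (auto simp: pc)
  qed
  obtain S where S: "S \<subseteq> V" "\<And>s. s \<in> S \<Longrightarrow> Nb s \<inter> S = {}"
      "\<And>p. p \<in> I \<Longrightarrow> S \<inter> insert (snd p) ` U p \<noteq> {}"
    using independent_transversal[of V I d Nb "\<lambda>p. insert (snd p) ` U p" t, OF fV fI d Nb T less]
    by blast
  show thesis
  proof (rule that[of S])
    show "S \<subseteq> {s. s \<subseteq> E \<and> card s = j + 1}" using S by (simp add: V_def)
    show "s = w" if "s \<in> S" "w \<in> S" "z \<subseteq> s \<inter> w" "card z = j" for s w z
    proof (rule ccontr)
      assume "s \<noteq> w"
      have sw: "s \<subseteq> E" "w \<subseteq> E" "card s = j + 1" "card w = j + 1" using that S by (auto simp: V_def)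
      \<comment> \<open>Removing the common \<open>j\<close>-set \<open>z\<close> from
        \<open>s\<close> leaves one element, so \<open>w\<close> would be a neighbour of
        \<open>s\<close>.\<close>
      have "card (s - w) \<le> card (s - z)" using that fE[OF sw(1)] by (intro card_mono) auto
      also have "\<dots> = 1" using that sw fE by (subst card_Diff_subset) (auto intro: finite_subset)
      finally have "w \<in> Nb s" using sw \<open>s \<noteq> w\<close> by (simp add: Nb_def)
      then show False using S(2) that by blast
    qed
    show "\<exists>x\<subseteq>X. card x = j \<and> insert c x \<in> S"
      if "X \<subseteq> E" "card X = 2 * j + 1" "c \<in> E - X" for X c
    proof -
      have p: "(X, c) \<in> I" using that by (simp add: I_def)
      show ?thesis using S(3)[OF p] U[OF p] by auto
    qed
  qed
qed

section \<open>Numerical estimate for a central binomial coefficient\<close>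

text \<open>From \<open>j\<close> to \<open>j + 1\<close> each of the five polynomial factors, the
  cube counting three times, grows by at most 6/5. So the left side grows by at most (6/5)^5 < 3,
  and the binomial coefficient by 2(2j+3)/(j+2) >= 3. The inequality fails at 16, whence the start
  at 17.\<close>

lemma central_binomial_ge_poly:
  fixes j :: nat
  assumes "j \<ge> 17"
  shows "(j ^ 2 + j + 15) ^ 3 * ((j ^ 2 + j + 2) * (j ^ 2 + 3 * j + 4)) \<le> 1024 * ((2 * j + 1) choose j)"
  using assms
proof (induction j rule: dec_induct)
  case base
  have "real ((35::nat) choose 17) = fact 35 / (fact 17 * fact 18)"
    by (subst binomial_fact) auto
  also have "\<dots> = 4537567650" by (simp add: fact_numeral)
  finally have "(35::nat) choose 17 = 4537567650" by linarith
  then show ?case by simp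
next
  case (step j)
  define p where "p = j ^ 2 + j + 15"
  define q where "q = j ^ 2 + j + 2"
  define r where "r = j ^ 2 + 3 * j + 4"
  define p' where "p' = (Suc j) ^ 2 + Suc j + 15"
  define r' where "r' = (Suc j) ^ 2 + 3 * Suc j + 4"
  define b where "b = (2 * j + 1) choose j"
  define b' where "b' = (2 * Suc j + 1) choose Suc j"
  \<comment> \<open>The first quadratic factor at \<open>Suc j\<close> is the second one at
    \<open>j\<close>, so growth is compared along \<open>q\<close>, \<open>r\<close>,
    \<open>r'\<close>.\<close>
  have q': "Suc j ^ 2 + Suc j + 2 = r" by (simp add: r_def power2_eq_square)
  have j2: "17 * j \<le> j * j" by (rule mult_right_mono) (use step.hyps in auto)
  have j17: "17 \<le> j" using step.hyps by simp
  have p': "5 * p' \<le> 6 * p" by (simp add: p_def p'_def power2_eq_square, use j2 j17 in linarith)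
  have r: "5 * r \<le> 6 * q" by (simp add: r_def q_def power2_eq_square, use j2 j17 in linarith)
  have r': "5 * r' \<le> 6 * r" by (simp add: r_def r'_def power2_eq_square, use j2 j17 in linarith)
  have "(5 * p') ^ 3 * ((5 * r) * (5 * r')) \<le> (6 * p) ^ 3 * ((6 * q) * (6 * r))"
    by (intro mult_mono power_mono p' r r') auto
  then have "3125 * (p' ^ 3 * (r * r')) \<le> 7776 * (p ^ 3 * (q * r))"
    by (simp add: power_mult_distrib mult_ac)
  also have "\<dots> \<le> 7776 * (1024 * b)"
    using step.IH by (simp add: p_def q_def r_def b_def)
  finally have *: "3125 * (p' ^ 3 * (r * r')) \<le> 7776 * (1024 * b)" .
  have "3 * b \<le> b'"
  proof -
    \<comment> \<open>Two absorption identities pass through (2j+2 choose j) and yield (j+2) b' =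
      2(2j+3) b.\<close>
    have 1: "b' * Suc j = (2 * j + 3) * ((2 * j + 2) choose j)"
    proof -
      have e: "2 * Suc j + 1 = Suc (2 * j + 2)" "2 * j + 3 = Suc (2 * j + 2)" by simp_all
      show ?thesis unfolding b'_def e by (rule Suc_times_binomial_eq[symmetric])
    qed
    have 2: "(j + 2) * ((2 * j + 2) choose j) = (2 * j + 2) * b"
    proof -
      have e: "2 * j + 2 - j = j + 2" "2 * j + 2 - 1 = 2 * j + 1" by simp_all
      show ?thesis using binomial_absorb_comp[of "2 * j + 2" j] unfolding e b_def .
    qed
    have "(j + 2) * b' * Suc j = (2 * j + 3) * ((j + 2) * ((2 * j + 2) choose j))"
      using 1 by (metis mult.assoc mult.left_commute)
    also have "\<dots> = (2 * (2 * j + 3) * b) * Suc j" unfolding 2 by (simp add: algebra_simps)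
    finally have "(j + 2) * b' = 2 * (2 * j + 3) * b" by (metis mult_cancel2 nat.distinct(1))
    moreover have "(j + 2) * (3 * b) \<le> 2 * (2 * j + 3) * b" by (simp add: algebra_simps)
    ultimately have "(j + 2) * (3 * b) \<le> (j + 2) * b'" by simp
    then show ?thesis by (rule mult_left_le_imp_le) simp
  qed
  with * have "p' ^ 3 * (r * r') \<le> 1024 * b'" by linarith
  then show ?case unfolding b'_def[symmetric] p'_def[symmetric] r'_def[symmetric] q' .
qed

section \<open>Copies of Boolean lattices meeting few layers\<close>

text \<open>Each added element raises \<open>g\<close> by at least 1. Climbing from the empty set to
  \<open>x\<close> bounds \<open>g x\<close> below, climbing from \<open>x\<close> to
  \<open>A\<close> bounds it above, and the cap on \<open>g A\<close> makes the bounds meet.\<close>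

lemma strict_mono_rank_eq_card:
  fixes g :: "'a set \<Rightarrow> nat"
  assumes A: "finite A"
    and mono: "\<And>x y. x \<subset> y \<Longrightarrow> y \<subseteq> A \<Longrightarrow> g x < g y"
    and le: "g A \<le> card A" and x: "x \<subseteq> A"
  shows "g x = card x"
proof -
  have step: "g x + card D \<le> g (x \<union> D)" if "finite D" "x \<union> D \<subseteq> A" "x \<inter> D = {}" for x D
    using that
  proof (induction D rule: finite_induct)
    case (insert d D)
    have "x \<union> D \<subset> x \<union> insert d D" using insert by auto
    then have "g (x \<union> D) < g (x \<union> insert d D)" using mono insert.prems by blast
    then show ?case using insert by auto
  qed simp
  have fx: "finite x" using A x finite_subset by blast
  have "card x \<le> g x" using step[of x "{}"] fx x by simp
  moreover have "g x + card (A - x) \<le> g A"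
    using step[of "A - x" x] A x by (simp add: Un_absorb1)
  ultimately show ?thesis using le A x fx card_mono[OF A x] by (simp add: card_Diff_subset)
qed

text \<open>Connectedness of the Johnson graph on \<open>Y\<close>: exchanging an element of
  \<open>z - x\<close> for one of \<open>x - z\<close> brings \<open>z\<close> closer to
  \<open>x\<close>.\<close>

lemma johnson_swap_induct:
  assumes Y: "finite Y" "x0 \<subseteq> Y" "x \<subseteq> Y" "card x = card x0" and P: "P x0"
    and step: "\<And>z \<gamma> \<delta>. z \<subseteq> Y \<Longrightarrow> card z = card x0 \<Longrightarrow> P z \<Longrightarrow> \<delta> \<in> z \<Longrightarrow> \<gamma> \<in> Y - z \<Longrightarrow>
      P (insert \<gamma> (z - {\<delta>}))"
  shows "P x"
proof -
  have fx: "finite x" using Y finite_subset by blast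
  have "P x" if "card (x - z) = n" "z \<subseteq> Y" "card z = card x0" "P z" for z n
    using that
  proof (induction n arbitrary: z)
    case 0
    then have "finite z" using Y finite_subset by blast
    have "x \<subseteq> z" using 0 fx by auto
    then have "x = z" using 0 Y \<open>finite z\<close> card_subset_eq by metis
    then show ?case using 0 by simp
  next
    case (Suc n)
    have fz: "finite z" using Suc Y finite_subset by blast
    obtain \<gamma> where \<gamma>: "\<gamma> \<in> x" "\<gamma> \<notin> z" using Suc.prems(1) by (metis DiffD1 DiffD2 card_eq_SucD insertI1)
    have "\<not> z \<subseteq> x" using \<gamma> Y Suc fx card_subset_eq by metis
    then obtain \<delta> where \<delta>: "\<delta> \<in> z" "\<delta> \<notin> x" by auto
    let ?z = "insert \<gamma> (z - {\<delta>})"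
    show ?case
    proof (rule Suc.IH)
      have "x - ?z = (x - z) - {\<gamma>}" using \<delta> by auto
      then show "card (x - ?z) = n" using Suc.prems(1) \<gamma> fx by simp
      show "?z \<subseteq> Y" using Suc \<gamma> Y by auto
      have "card ?z = Suc (card (z - {\<delta>}))" using fz \<gamma> by simp
      then show "card ?z = card x0" using fz \<delta> Suc by (metis card_Suc_Diff1)
      show "P ?z" using step Suc \<gamma> \<delta> Y by auto
    qed
  qed
  then show ?thesis using Y P by blast
qed

lemma strict_mono_on_inj_mono:
  fixes f :: "'a :: order \<Rightarrow> 'b :: order"
  assumes "inj_on f P" "mono_on P f" "x \<in> P" "y \<in> P" "x < y"
  shows "f x < f y"
proof -
  have "f x \<le> f y" using assms by (intro mono_onD[OF assms(2)]) auto
  moreover have "f x \<noteq> f y" using assms by (auto dest: inj_onD)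
  ultimately show ?thesis by simp
qed

text \<open>Singletons define an injection \<open>a\<close>, and on levels \<open>j\<close> and
  \<open>j + 1\<close> the set \<open>F x\<close> has one extra element \<open>u x\<close>. If on
  level \<open>j\<close> this never lies in the image of \<open>A\<close> under \<open>a\<close>, it
  is constant there. Otherwise some value \<open>a \<beta>\<close> occurs, and injectivity of
  \<open>F\<close> spreads it to all \<open>j\<close>-sets avoiding \<open>\<beta>\<close>; giving
  up \<open>\<beta>\<close> accounts for \<open>card A - 1\<close>.\<close>

lemma rank_shifted_copy_structure:
  fixes F :: "'a set \<Rightarrow> 'b set"
  assumes A: "finite A" and j: "j \<ge> 2" "j < card A"
    and inj: "inj_on F (Pow A)"
    and mono: "\<And>x y. x \<subseteq> y \<Longrightarrow> y \<subseteq> A \<Longrightarrow> F x \<subseteq> F y"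
    and c1: "\<And>i. i \<in> A \<Longrightarrow> card (F {i}) = 1"
    and c2: "\<And>x. x \<subseteq> A \<Longrightarrow> card x \<in> {j, j + 1} \<Longrightarrow> card (F x) = card x + 1"
  obtains X c where "X \<subseteq> F A" "c \<in> F A - X" "card A - 1 \<le> card X"
    "\<And>x. x \<subseteq> X \<Longrightarrow> card x = j \<Longrightarrow> insert c x \<in> F ` Pow A"
proof -
  have "\<exists>a. \<forall>i\<in>A. F {i} = {a i}"
    using c1 by (intro bchoice) (auto simp: card_1_singleton_iff)
  then obtain a where a: "\<And>i. i \<in> A \<Longrightarrow> F {i} = {a i}" by blast
  have a_inj: "inj_on a A"
  proof (rule inj_onI)
    fix i k assume "i \<in> A" "k \<in> A" "a i = a k"
    then have "F {i} = F {k}" by (simp add: a)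
    then show "i = k" using inj \<open>i \<in> A\<close> \<open>k \<in> A\<close> by (metis PowI empty_subsetI inj_onD insert_subset singleton_inject)
  qed
  have aF: "a ` x \<subseteq> F x" if "x \<subseteq> A" for x
  proof
    fix b assume "b \<in> a ` x"
    then obtain i where "i \<in> x" "b = a i" by auto
    then show "b \<in> F x" using mono[of "{i}" x] a[of i] that by auto
  qed
  have cx: "card (a ` x) = card x" if "x \<subseteq> A" for x
    using that a_inj by (meson card_image inj_on_subset)
  have fA: "finite x" if "x \<subseteq> A" for x using that A finite_subset by blast
  have "\<exists>u. \<forall>x\<in>{x. x \<subseteq> A \<and> card x \<in> {j, j + 1}}. F x = insert (u x) (a ` x) \<and> u x \<notin> a ` x"
  proof (rule bchoice, clarify)
    fix x assume x: "x \<subseteq> A" "card x \<in> {j, j + 1}"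
    have "card (F x - a ` x) = 1"
      using c2[OF x] aF[OF x(1)] cx[OF x(1)] fA[OF x(1)] by (simp add: card_Diff_subset)
    then obtain v where "F x - a ` x = {v}" by (auto simp: card_1_singleton_iff)
    then show "\<exists>v. F x = insert v (a ` x) \<and> v \<notin> a ` x" using aF[OF x(1)] by (intro exI[of _ v]) blast
  qed
  then obtain u where u: "\<And>x. x \<subseteq> A \<Longrightarrow> card x \<in> {j, j + 1} \<Longrightarrow> F x = insert (u x) (a ` x) \<and> u x \<notin> a ` x"
    by blast
  have ain: "a i \<in> a ` x \<longleftrightarrow> i \<in> x" if "i \<in> A" "x \<subseteq> A" for i x
    using that a_inj by (meson inj_on_image_mem_iff)
  \<comment> \<open>Beyond the image of \<open>x\<close>, the larger set
    \<open>F (insert \<gamma> x)\<close> has only \<open>a \<gamma>\<close> and its own extra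
    element to offer for \<open>u x\<close>.\<close>
  have edge: "u x = u (insert \<gamma> x) \<or> u x = a \<gamma>"
    if "x \<subseteq> A" "card x = j" "\<gamma> \<in> A - x" for x \<gamma>
  proof -
    have "F x \<subseteq> F (insert \<gamma> x)" using mono that by (simp add: subset_insertI)
    moreover have "card (insert \<gamma> x) = j + 1" using that fA[of x] by auto
    ultimately show ?thesis using u[of x] u[of "insert \<gamma> x"] that by auto
  qed
  have u': "F (insert \<gamma> x) = insert (u (insert \<gamma> x)) (a ` insert \<gamma> x)" "u (insert \<gamma> x) \<notin> a ` insert \<gamma> x"
    if "x \<subseteq> A" "card x = j" "\<gamma> \<in> A - x" for x \<gamma>
    using u[of "insert \<gamma> x"] that fA[of x] by auto
  have swap: "insert \<gamma> (x - {\<delta>}) \<subseteq> A" "card (insert \<gamma> (x - {\<delta>})) = j"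
    if "x \<subseteq> A" "card x = j" "\<gamma> \<in> A - x" "\<delta> \<in> x" for x \<gamma> \<delta>
    using that fA[of x] card_Suc_Diff1[of x \<delta>] by auto
  obtain x1 where x1: "x1 \<subseteq> A" "card x1 = j" using j obtain_subset_with_card_n[of j A] by auto
  show thesis
  proof (cases "\<exists>x \<subseteq> A. card x = j \<and> u x \<in> a ` A")
    case False
    \<comment> \<open>An exchange goes up to \<open>insert \<gamma> z\<close> and down again; the
      second alternative of \<open>edge\<close> is excluded both times.\<close>
    have const: "u x = u x1" if x: "x \<subseteq> A" "card x = j" for x
    proof (rule johnson_swap_induct[where P = "\<lambda>x. u x = u x1" and Y = A and ?x0.0 = x1])
      fix z \<gamma> \<delta> assume z: "z \<subseteq> A" "card z = card x1" "u z = u x1" "\<delta> \<in> z" "\<gamma> \<in> A - z"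
      let ?z = "insert \<gamma> (z - {\<delta>})"
      have zc: "card z = j" using z x1 by simp
      have "u z = u (insert \<gamma> z)" using edge[OF z(1) zc z(5)] False z zc by (metis DiffD1 imageI)
      moreover have "u ?z = u (insert \<delta> ?z)"
      proof -
        have "a \<delta> \<in> a ` A" "\<delta> \<in> A - ?z" using z by auto
        then show ?thesis using edge[OF swap[OF z(1) zc z(5,4)], of \<delta>] False swap[OF z(1) zc z(5,4)] by metis
      qed
      moreover have "insert \<delta> ?z = insert \<gamma> z" using z by auto
      ultimately show "u ?z = u x1" using z by simp
    qed (use A x x1 in auto)
    have "u x1 \<in> F A" using u[OF x1(1)] x1 mono[of x1 A] by auto
    show thesis
    proof (rule that[of "a ` A" "u x1"])
      show "insert (u x1) x \<in> F ` Pow A" if xa: "x \<subseteq> a ` A" and "card x = j" for x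
      proof -
        obtain x' where x': "x' \<subseteq> A" "x = a ` x'" by (rule subset_imageE[OF xa])
        then have "card x' = j" using cx that by metis
        then have "F x' = insert (u x1) x" using u[OF x'(1)] const[OF x'(1)] x' by simp
        then show ?thesis using x' by (metis PowI imageI)
      qed
    qed (use aF \<open>u x1 \<in> F A\<close> False x1 cx in auto)
  next
    case True
    then obtain x0 \<beta> where x0: "x0 \<subseteq> A" "card x0 = j" "u x0 = a \<beta>" "\<beta> \<in> A" by auto
    have "\<beta> \<notin> x0" using u[OF x0(1)] x0 by auto
    have const: "u x = a \<beta>" if x: "x \<subseteq> A - {\<beta>}" "card x = j" for x
    proof (rule johnson_swap_induct[where P = "\<lambda>x. u x = a \<beta>" and Y = "A - {\<beta>}" and ?x0.0 = x0])
      fix x \<gamma> \<delta> assume asm: "x \<subseteq> A - {\<beta>}" "card x = card x0" "u x = a \<beta>" "\<delta> \<in> x" "\<gamma> \<in> A - {\<beta>} - x"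
      then have x: "x \<subseteq> A" "card x = j" "\<gamma> \<in> A - x" "\<beta> \<in> A - x" "\<gamma> \<noteq> \<beta>" "\<delta> \<in> A"
        using x0 by auto
      \<comment> \<open>The \<open>j\<close>-set \<open>?w\<close>, with \<open>\<beta>\<close> in
        place of \<open>\<delta>\<close>, is an auxiliary third set: if \<open>u\<close> changed
        from \<open>x\<close> to \<open>?z\<close>, injectivity would fail around it.\<close>
      let ?z = "insert \<gamma> (x - {\<delta>})" and ?w = "insert \<beta> (x - {\<delta>})"
      have z: "?z \<subseteq> A" "card ?z = j" and w: "?w \<subseteq> A" "card ?w = j"
        using swap[of x \<gamma> \<delta>] swap[of x \<beta> \<delta>] x asm by auto
      have ne: "a \<gamma> \<noteq> a \<beta>" "a \<delta> \<noteq> a \<beta>" "a \<delta> \<noteq> a \<gamma>" using a_inj x x0 asm by (auto simp: inj_on_eq_iff)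
      have y': "u (insert \<gamma> x) = a \<beta>" using edge[of x \<gamma>] x asm ne by auto
      have z\<delta>: "insert \<delta> ?z = insert \<gamma> x" and w\<delta>: "insert \<delta> ?w = insert \<beta> x"
        and wz: "insert \<gamma> ?w = insert \<beta> ?z" using asm by auto
      show "u ?z = a \<beta>"
      proof (rule ccontr)
        assume "u ?z \<noteq> a \<beta>"
        \<comment> \<open>Above \<open>?z\<close>, at \<open>insert \<gamma> x\<close>, the extra
          element is \<open>a \<beta>\<close>, so \<open>edge\<close> leaves only
          \<open>a \<delta>\<close>. That value then persists at
          \<open>insert \<beta> ?z\<close>.\<close>
        then have uz: "u ?z = a \<delta>" using edge[of ?z \<delta>] z z\<delta> y' x asm by auto
        have uzw: "u (insert \<beta> ?z) = a \<delta>"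
          using edge[of ?z \<beta>] z uz ne x asm by auto
        have Fx: "F x = a ` insert \<beta> x" using u[of x] x asm by auto
        have "u ?w \<noteq> a \<delta>"
        proof
          assume "u ?w = a \<delta>"
          then have "F ?w = a ` insert \<delta> ?w" using u[of ?w] w by auto
          then have "F ?w = F x" using Fx w\<delta> by simp
          then have "?w = x" using inj w x by (auto dest: inj_onD)
          then show False using asm by auto
        qed
        then have uw: "u ?w = u (insert \<beta> x)" using edge[of ?w \<delta>] w w\<delta> asm x by auto
        have "u (insert \<beta> x) \<noteq> a \<delta>" using u'[of x \<beta>] x asm by auto
        \<comment> \<open>From \<open>?w\<close> up to \<open>insert \<gamma> ?w\<close>,
          \<open>edge\<close> permits only \<open>a \<delta>\<close> and \<open>a \<gamma>\<close>.
          Then \<open>insert \<beta> x\<close> and \<open>insert \<gamma> x\<close> have the same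
          image under \<open>F\<close>.\<close>
        then have "u (insert \<beta> x) = a \<gamma>"
          using edge[of ?w \<gamma>] w uw wz uzw x asm by auto
        then have "F (insert \<beta> x) = F (insert \<gamma> x)" using u'[of x \<beta>] u'[of x \<gamma>] x y' by auto
        then have "insert \<beta> x = insert \<gamma> x" by (rule inj_onD[OF inj]) (use x in auto)
        then show False using x by auto
      qed
    qed (use A x x0 \<open>\<beta> \<notin> x0\<close> in auto)
    show thesis
    proof (rule that[of "a ` (A - {\<beta>})" "a \<beta>"])
      show "a ` (A - {\<beta>}) \<subseteq> F A" using aF[of A] by auto
      show "a \<beta> \<in> F A - a ` (A - {\<beta>})" using aF[of A] x0 ain[of \<beta> "A - {\<beta>}"] by auto
      show "card A - 1 \<le> card (a ` (A - {\<beta>}))" using cx[of "A - {\<beta>}"] A x0 by auto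
      show "insert (a \<beta>) x \<in> F ` Pow A" if xa: "x \<subseteq> a ` (A - {\<beta>})" and "card x = j" for x
      proof -
        obtain x' where x': "x' \<subseteq> A - {\<beta>}" "x = a ` x'" by (rule subset_imageE[OF xa])
        then have "x' \<subseteq> A" by auto
        then have "card x' = j" using cx x' that by metis
        then have "F x' = insert (a \<beta>) x" using u[OF \<open>x' \<subseteq> A\<close>] const[OF x'(1)] x' by simp
        then show ?thesis using \<open>x' \<subseteq> A\<close> by (metis PowI imageI)
      qed
    qed
  qed
qed

section \<open>Choice of the parameter\<close>

text \<open>Squaring the bound on \<open>n\<close> gives 32(n+m) <= (n-2)^2 + 60. With n - 2 equal
  to 2j or 2j+1 this yields 8(n+m) <= j^2 + j + 15, and cubing the 8 explains 1024 = 2 * 8^3 in the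
  binomial estimate.\<close>

lemma code_parameter_exists:
  fixes n m :: nat
  assumes m: "m \<ge> 2" and nm: "real n \<ge> sqrt (32 * real m + 260) + 18"
  obtains j where "j \<ge> 17" "2 * j + 2 \<le> n"
    "(n + m) ^ 3 * ((j ^ 2 + j + 2) * (j ^ 2 + 3 * j + 4)) \<le> 2 * ((2 * j + 1) choose j)"
proof -
  \<comment> \<open>At m = 2 the radicand is 324 = 18^2, so n >= 36 and the later choice of
    \<open>j\<close> is at least 17.\<close>
  have "sqrt (32 * real m + 260) \<ge> sqrt (18 ^ 2)"
    using m by (intro real_sqrt_le_mono) simp
  then have n36: "n \<ge> 36" using nm by simp
  have "(sqrt (32 * real m + 260)) ^ 2 \<le> (real n - 18) ^ 2"
    using nm by (intro power_mono) auto
  then have "32 * real m + 260 \<le> (real n - 18) ^ 2" by simp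
  then have "real (32 * m + 36 * n) \<le> real (n ^ 2 + 64)"
    by (simp add: power2_eq_square algebra_simps)
  then have nm': "32 * m + 36 * n \<le> n ^ 2 + 64" unfolding of_nat_le_iff .
  \<comment> \<open>The largest \<open>j\<close> for which n - 1 points still contain a set of 2j +
    1.\<close>
  define j where "j = (n - 2) div 2"
  have j17: "j \<ge> 17" and jn: "2 * j + 2 \<le> n" using n36 by (auto simp: j_def)
  have "n = 2 * j + 2 \<or> n = 2 * j + 3" using n36 by (auto simp: j_def)
  then have le: "8 * (n + m) \<le> j ^ 2 + j + 15"
    using nm' by (auto simp: power2_eq_square algebra_simps)
  define Q where "Q = (j ^ 2 + j + 2) * (j ^ 2 + 3 * j + 4)"
  have "512 * ((n + m) ^ 3 * Q) = (8 * (n + m)) ^ 3 * Q"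
    unfolding power_mult_distrib by simp
  also have "\<dots> \<le> (j ^ 2 + j + 15) ^ 3 * Q"
    by (intro mult_right_mono power_mono le) auto
  also have "\<dots> \<le> 1024 * ((2 * j + 1) choose j)"
    unfolding Q_def by (rule central_binomial_ge_poly[OF j17])
  finally have "(n + m) ^ 3 * Q \<le> 2 * ((2 * j + 1) choose j)" by linarith
  then show thesis using that[OF j17 jn] by (simp add: Q_def)
qed

section \<open>The colouring and its verification\<close>

lemma card_less_of_copy:
  fixes F :: "'a set \<Rightarrow> 'b set"
  assumes "F ` Pow A \<subseteq> Pow E" "finite E" "inj_on F (Pow A)" "mono_on (Pow A) F"
    and xy: "x \<subset> y" "y \<subseteq> A"
  shows "card (F x) < card (F y)"
proof (rule psubset_card_mono)
  have "F y \<subseteq> E" using assms(1) xy(2) by auto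
  then show "finite (F y)" by (rule finite_subset[OF _ assms(2)])
  show "F x \<subset> F y" by (rule strict_mono_on_inj_mono[OF assms(3,4)]) (use xy in auto)
qed

theorem theorem4:
  fixes n m :: nat
  assumes "n \<ge> 1" and "m \<ge> 2"
    and "real n \<ge> sqrt (32 * real m + 260) + 18"
  shows "\<exists>B R :: nat set set.
    B \<subseteq> boolean_lattice (n + m) \<and> R \<subseteq> boolean_lattice (n + m) \<and>
    B \<inter> R = {} \<and> B \<union> R = boolean_lattice (n + m) \<and>
    \<not> weak_subposet (boolean_lattice m) B \<and>
    \<not> weak_subposet (boolean_lattice n) R"
proof -
  define E where "E = {1..n + m}"
  have E: "finite E" "card E = n + m" by (auto simp: E_def)
  obtain j where j: "j \<ge> 17" "2 * j + 2 \<le> n"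
    "(n + m) ^ 3 * ((j ^ 2 + j + 2) * (j ^ 2 + 3 * j + 4)) \<le> 2 * ((2 * j + 1) choose j)"
    using code_parameter_exists[OF assms(2,3)] by blast
  obtain S where S: "S \<subseteq> {s. s \<subseteq> E \<and> card s = j + 1}"
    and S_code: "\<And>s t z. s \<in> S \<Longrightarrow> t \<in> S \<Longrightarrow> z \<subseteq> s \<inter> t \<Longrightarrow> card z = j \<Longrightarrow> s = t"
    and S_hit: "\<And>X c. X \<subseteq> E \<Longrightarrow> card X = 2 * j + 1 \<Longrightarrow> c \<in> E - X \<Longrightarrow>
      \<exists>x\<subseteq>X. card x = j \<and> insert c x \<in> S"
    using exists_johnson_code[of E j] E j by auto
  define B where "B = {s. s \<subseteq> E \<and> (card s = j \<or> card s \<in> {j + 3..j + m + 1})} \<union> S"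
  define R where "R = Pow E - B"
  have "\<not> weak_subposet (boolean_lattice m) B"
  proof
    assume "weak_subposet (boolean_lattice m) B"
    then obtain F where F: "F ` Pow {1..m} \<subseteq> B" "inj_on F (Pow {1..m})" "mono_on (Pow {1..m}) F"
      unfolding weak_subposet_def boolean_lattice_def by blast
    have FE: "F ` Pow {1..m} \<subseteq> Pow E" using F(1) S by (auto simp: B_def)
    have lev: "card (F x) \<in> {j, j + 1} \<union> {j + 3..j + m + 1}" if "x \<subseteq> {1..m}" for x
      using F(1) that S by (auto simp: B_def)
    \<comment> \<open>Numbers the blue sizes j, j+1, j+3, ..., j+m+1 consecutively from 0 to m,
      closing the gap at j+2.\<close>
    define r where "r t = (if t \<le> j + 1 then t - j else t - (j + 1))" for t
    have rank: "r (card (F x)) = card x" if "x \<subseteq> {1..m}" for x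
    proof (rule strict_mono_rank_eq_card[of "{1..m}"])
      fix x y :: "nat set" assume xy: "x \<subset> y" "y \<subseteq> {1..m}"
      then have x: "x \<subseteq> {1..m}" by auto
      from xy have "card (F x) < card (F y)" by (rule card_less_of_copy[OF FE E(1) F(2,3)])
      then show "r (card (F x)) < r (card (F y))"
        using lev[OF x] lev[OF xy(2)] by (auto simp: r_def)
    next
      show "r (card (F {1..m})) \<le> card {1..m}" using lev[of "{1..m}"] assms(2) by (auto simp: r_def)
    qed (use that in auto)
    have "card (F {}) = j" using rank[of "{}"] lev[of "{}"] by (auto simp: r_def split: if_splits)
    have FS: "F {i} \<in> S" if "i \<in> {1, 2}" for i
    proof -
      have i: "{i} \<subseteq> {1..m}" using that assms(2) by auto
      then have "card (F {i}) = j + 1" using rank[of "{i}"] lev[of "{i}"] by (auto simp: r_def split: if_splits)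
      moreover have "F {i} \<in> B" using F(1) i by blast
      ultimately show ?thesis by (auto simp: B_def)
    qed
    \<comment> \<open>Both atoms lie above the \<open>j\<close>-set \<open>F {}\<close>, so the code
      property identifies them.\<close>
    have "F {} \<subseteq> F {i}" if "i \<in> {1, 2}" for i
      using that assms(2) by (intro mono_onD[OF F(3)]) auto
    then have "F {1} = F {2}"
      using \<open>card (F {}) = j\<close> FS by (intro S_code[of "F {1}" "F {2}" "F {}"]) auto
    then have "{1 :: nat} = {2}" by (rule inj_onD[OF F(2)]) (use assms(2) in auto)
    then show False by simp
  qed
  moreover have "\<not> weak_subposet (boolean_lattice n) R"
  proof
    assume "weak_subposet (boolean_lattice n) R"
    then obtain F where F: "F ` Pow {1..n} \<subseteq> R" "inj_on F (Pow {1..n})" "mono_on (Pow {1..n}) F"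
      unfolding weak_subposet_def boolean_lattice_def by blast
    have FE: "F ` Pow {1..n} \<subseteq> Pow E" using F(1) by (auto simp: R_def)
    have lev: "card (F x) \<in> {..<j} \<union> {j + 1, j + 2} \<union> {j + m + 2..n + m}" if "x \<subseteq> {1..n}" for x
    proof -
      have "F x \<subseteq> E" "F x \<notin> B" using F(1) that by (auto simp: R_def)
      then show ?thesis using card_mono[OF E(1), of "F x"] E(2) by (auto simp: B_def)
    qed
    \<comment> \<open>Numbers the red sizes consecutively from 0 to n. Ranks below \<open>j\<close>
      keep their size, while ranks \<open>j\<close> and \<open>j + 1\<close> land one layer higher,
      as the structure lemma requires.\<close>
    define r where "r t = (if t \<le> j then t else if t \<le> j + 2 then t - 1 else t - m)" for t
    have rank: "r (card (F x)) = card x" if "x \<subseteq> {1..n}" for x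
    proof (rule strict_mono_rank_eq_card[of "{1..n}"])
      fix x y :: "nat set" assume xy: "x \<subset> y" "y \<subseteq> {1..n}"
      then have x: "x \<subseteq> {1..n}" by auto
      from xy have "card (F x) < card (F y)" by (rule card_less_of_copy[OF FE E(1) F(2,3)])
      then show "r (card (F x)) < r (card (F y))"
        using lev[OF x] lev[OF xy(2)] by (auto simp: r_def)
    next
      show "r (card (F {1..n})) \<le> card {1..n}" using lev[of "{1..n}"] j by (auto simp: r_def)
    qed (use that in auto)
    obtain X c where X: "X \<subseteq> F {1..n}" "c \<in> F {1..n} - X" "card {1..n} - 1 \<le> card X"
      and hit: "\<And>x. x \<subseteq> X \<Longrightarrow> card x = j \<Longrightarrow> insert c x \<in> F ` Pow {1..n}"
    proof (rule rank_shifted_copy_structure[of "{1..n}" j F])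
      show "F x \<subseteq> F y" if "x \<subseteq> y" "y \<subseteq> {1..n}" for x y
        using that by (intro mono_onD[OF F(3)]) auto
      show "card (F {i}) = 1" if "i \<in> {1..n}" for i
        using rank[of "{i}"] lev[of "{i}"] that j by (auto simp: r_def split: if_splits)
      show "card (F x) = card x + 1" if "x \<subseteq> {1..n}" "card x \<in> {j, j + 1}" for x
        using rank[of x] lev[of x] that j by (auto simp: r_def split: if_splits)
    qed (use j F(2) in auto)
    have FnE: "F {1..n} \<subseteq> E" using FE by auto
    \<comment> \<open>\<open>X\<close> has at least n - 1 >= 2j + 1 points, so it contains a set to
      which \<open>S_hit\<close> applies.\<close>
    obtain Y where Y: "Y \<subseteq> X" "card Y = 2 * j + 1"
    proof -
      have "2 * j + 1 \<le> card X" using X(3) j(2) by simp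
      then show thesis using that by (rule obtain_subset_with_card_n)
    qed
    obtain x where x: "x \<subseteq> Y" "card x = j" "insert c x \<in> S"
      using S_hit[of Y c] Y X FnE by auto
    \<comment> \<open>The same set is red as an image under \<open>F\<close> and blue as a member of
      \<open>S\<close>.\<close>
    then have "insert c x \<in> R" using hit[of x] Y F(1) by auto
    then show False using x by (simp add: R_def B_def)
  qed
  ultimately show ?thesis
    using S by (intro exI[of _ B] exI[of _ R]) (auto simp: boolean_lattice_def B_def R_def E_def)
qed

end
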